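(* Let $r\colon\mathbb{N}\to\mathbb{R}_0^+$ be a non-decreasing function. If all planar graphs of treewidth at most two are fractionally $\mathrm{td}$-fragile at rate $r$, then $r(a)=\Omega(a^2)$ (as $a\to\infty$).
   Context: All graphs are finite. The treedepth $\mathrm{td}(G)$ of a graph $G$ is the minimum integer $d$ for which there exists a rooted forest $T$ of depth at most $d-1$ (each vertex is at distance at most $d-1$ from the root of its tree) with vertex set $V(G)$ such that every edge of $G$ joins a vertex to one of its ancestors or descendants in $T$; the empty graph has treedepth $0$. For $\varepsilon>0$, a probability distribution on subsets of $V(G)$ is $\varepsilon$-thin if for each vertex $v$, the probability that $v$ belongs to a set sampled from the distribution is at most $\varepsilon$. For a graph parameter $f$ and a non-decreasing function $r\colon\mathbb{N}\to\mathbb{R}_0^+$, a graph $G$ is fractionally $f$-fragile at rate $r$ if for every positive integer $a$ there exists a $(1/a)$-thin probability distribution on the collection of sets $Y\subseteq V(G)$ satisfying $f(G-Y)\le r(a)$. *)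

theory Defs
  imports "HOL-Probability.Probability" "HOL-Library.Landau_Symbols"
begin

section \<open>Finite simple graphs\<close>

record 'a ugraph =
  verts :: "'a set"
  edges :: "'a set set"

definition simple_graph :: "'a ugraph \<Rightarrow> bool" where
  "simple_graph G \<longleftrightarrow> finite (verts G) \<and> (\<forall>e\<in>edges G. e \<subseteq> verts G \<and> card e = 2)"

definition induced_subgraph :: "'a ugraph \<Rightarrow> 'a set \<Rightarrow> 'a ugraph" where
  "induced_subgraph G S = \<lparr>verts = S, edges = {e \<in> edges G. e \<subseteq> S}\<rparr>"

definition delete_verts :: "'a ugraph \<Rightarrow> 'a set \<Rightarrow> 'a ugraph" where
  "delete_verts G Y = induced_subgraph G (verts G - Y)"

definition connected_graph :: "'a ugraph \<Rightarrow> bool" where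
  "connected_graph G \<longleftrightarrow> verts G \<noteq> {} \<and>
     (\<forall>u\<in>verts G. \<forall>v\<in>verts G. (u, v) \<in> {(x, y). {x, y} \<in> edges G}\<^sup>*)"

text \<open>A cycle is given by the list of its vertices in cyclic order, without repetition.\<close>

definition is_cycle :: "'a ugraph \<Rightarrow> 'a list \<Rightarrow> bool" where
  "is_cycle G xs \<longleftrightarrow> 3 \<le> length xs \<and> distinct xs \<and>
     (\<forall>i<length xs. {xs ! i, xs ! (Suc i mod length xs)} \<in> edges G)"

definition is_tree :: "'a ugraph \<Rightarrow> bool" where
  "is_tree G \<longleftrightarrow> simple_graph G \<and> connected_graph G \<and> (\<nexists>xs. is_cycle G xs)"


section \<open>Planarity\<close>

text \<open>
  A drawing maps vertices to distinct points and edges to arcs in the plane, such that the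
  relative interior of each edge contains no vertex and no point of another edge.
\<close>

definition plane_drawing :: "'a ugraph \<Rightarrow> ('a \<Rightarrow> complex) \<Rightarrow> ('a set \<Rightarrow> real \<Rightarrow> complex) \<Rightarrow> bool" where
  "plane_drawing G pos c \<longleftrightarrow> inj_on pos (verts G) \<and>
     (\<forall>e\<in>edges G. arc (c e) \<and> {pathstart (c e), pathfinish (c e)} = pos ` e \<and>
        (path_image (c e) - pos ` e) \<inter> pos ` verts G = {} \<and>
        (\<forall>e'\<in>edges G. e' \<noteq> e \<longrightarrow> (path_image (c e) - pos ` e) \<inter> path_image (c e') = {}))"

definition planar :: "'a ugraph \<Rightarrow> bool" where
  "planar G \<longleftrightarrow> (\<exists>pos c. plane_drawing G pos c)"


section \<open>Treewidth\<close>

definition tree_decomposition :: "'a ugraph \<Rightarrow> 'b ugraph \<Rightarrow> ('b \<Rightarrow> 'a set) \<Rightarrow> bool" where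
  "tree_decomposition G T B \<longleftrightarrow> is_tree T \<and>
     (\<Union>t\<in>verts T. B t) = verts G \<and>
     (\<forall>e\<in>edges G. \<exists>t\<in>verts T. e \<subseteq> B t) \<and>
     (\<forall>v\<in>verts G. connected_graph (induced_subgraph T {t \<in> verts T. v \<in> B t}))"

text \<open>
  The minimum over all tree decompositions of the size of a largest bag, minus one. Since
  decomposition trees are finite, taking their nodes to be natural numbers is no restriction.
  The result is an integer because the graph without vertices has treewidth \<open>-1\<close>.
\<close>

definition treewidth :: "'a ugraph \<Rightarrow> int" where
  "treewidth G = int (LEAST k. \<exists>(T :: nat ugraph) B. tree_decomposition G T B \<and>
     (\<forall>t\<in>verts T. card (B t) \<le> k)) - 1"


section \<open>Treedepth\<close>

text \<open>
  A rooted forest with vertex set \<open>V\<close> is given by its parent relation: \<open>(v, u) \<in> P\<close> means that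
  \<open>u\<close> is the parent of \<open>v\<close>. The roots are the vertices without a parent, and \<open>(v, u) \<in> P\<^sup>+\<close>
  means that \<open>u\<close> is a proper ancestor of \<open>v\<close>.
\<close>

definition rooted_forest :: "'a set \<Rightarrow> ('a \<times> 'a) set \<Rightarrow> bool" where
  "rooted_forest V P \<longleftrightarrow> P \<subseteq> V \<times> V \<and> single_valued P \<and> acyclic P"

definition roots :: "'a set \<Rightarrow> ('a \<times> 'a) set \<Rightarrow> 'a set" where
  "roots V P = {v \<in> V. v \<notin> Domain P}"

text \<open>
  The distance from a vertex to the root of its tree is the length of the chain of parents
  leading there. Writing ``at most \<open>d - 1\<close>'' as ``less than \<open>d\<close>'' makes the case \<open>d = 0\<close>
  apply exactly to the empty forest.
\<close>

definition forest_depth_less :: "'a set \<Rightarrow> ('a \<times> 'a) set \<Rightarrow> nat \<Rightarrow> bool" where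
  "forest_depth_less V P d \<longleftrightarrow> (\<forall>v\<in>V. \<exists>\<rho>\<in>roots V P. \<exists>k<d. (v, \<rho>) \<in> P ^^ k)"

definition treedepth :: "'a ugraph \<Rightarrow> nat" where
  "treedepth G = (LEAST d. \<exists>P. rooted_forest (verts G) P \<and> forest_depth_less (verts G) P d \<and>
     (\<forall>e\<in>edges G. \<exists>u v. e = {u, v} \<and> (u, v) \<in> P\<^sup>+))"


section \<open>Fractional fragility\<close>

definition thin :: "real \<Rightarrow> 'a set \<Rightarrow> 'a set pmf \<Rightarrow> bool" where
  "thin \<epsilon> V p \<longleftrightarrow> set_pmf p \<subseteq> Pow V \<and> (\<forall>v\<in>V. measure_pmf.prob p {Y. v \<in> Y} \<le> \<epsilon>)"

definition fractionally_fragile ::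
  "('a ugraph \<Rightarrow> nat) \<Rightarrow> (nat \<Rightarrow> real) \<Rightarrow> 'a ugraph \<Rightarrow> bool" where
  "fractionally_fragile f r G \<longleftrightarrow> (\<forall>a>0. \<exists>p. thin (1 / real a) (verts G) p \<and>
     (\<forall>Y\<in>set_pmf p. real (f (delete_verts G Y)) \<le> r a))"

end

theory Submission
  imports Defs "HOL-Library.Nat_Bijection" "HOL-Library.List_Lexorder" "HOL-Library.Sublist"
begin

text \<open>
  Take a tree in which every vertex has many children, join all its vertices to a new apex, and
  let every vertex of the tree again be the apex of such a tree, and so on. Adding a vertex to the
  graph adjoins it to one vertex or to an edge, so the treewidth is at most two; in preorder, the
  parent edges and the apex edges each form one page of a book embedding, so the graph is planar.

  Delete a set \<open>Y\<close> leaving treedepth at most \<open>s\<^sup>2\<close>, and follow a uniformly random branch. Give a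
  surviving vertex as rank the height that an elimination forest reserves for its component within
  its subtree. Passing to a child lowers the rank by one, with at most one exceptional child, and
  the rank never exceeds that of the surviving apex. Hence in a run of \<open>L\<close> surviving vertices of one
  tree the rank drops by about \<open>L/2\<close> below the apex on average, whereas a deletion lets
  the rank recover only up to that of the apex, or up to \<open>s\<^sup>2\<close> when the apex is deleted. If trees are left
  with probability \<open>1/(2s)\<close> per step, the two effects balance when \<open>Y\<close> meets the branch about once every
  \<open>O(s)\<close> steps. So a \<open>1/a\<close>-thin distribution with \<open>a \<ge> 8s\<close> cannot keep the treedepth at most \<open>s\<^sup>2\<close>.
\<close>

section \<open>Book embeddings\<close>

text \<open>Vertices go on the real axis, edges of \<open>E\<close> above it and all others below.
  Arcs on one page that share an inner point span nested intervals, by \<open>noncrossing\<close>,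
  and the parabola over the larger interval is strictly higher there.\<close>

lemma planar_if_two_page_book:
  fixes pos :: "'a \<Rightarrow> real"
  assumes G: "simple_graph G" and inj: "inj_on pos (verts G)"
    and noncrossing: "\<And>u v u' v'. {u, v} \<in> edges G \<Longrightarrow> {u', v'} \<in> edges G \<Longrightarrow>
      ({u, v} \<in> E \<longleftrightarrow> {u', v'} \<in> E) \<Longrightarrow>
      \<not> (pos u < pos u' \<and> pos u' < pos v \<and> pos v < pos v')"
  shows "planar G"
proof -
  define lo hi where "lo e = Min (pos ` e)" and "hi e = Max (pos ` e)" for e
  define sg :: "'a set \<Rightarrow> real" where "sg e = (if e \<in> E then 1 else - 1)" for e
  \<comment> \<open>Edges are drawn as parabolas: two with equal height at an inner point cannot be nested.\<close>
  define pt where "pt e x = Complex x (sg e * ((x - lo e) * (hi e - x)))" for e x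
  define c where "c e t = pt e (linepath (lo e) (hi e) t)" for e t
  define ps where "ps = complex_of_real \<circ> pos"
  have edge: "\<exists>u v. e = {u, v} \<and> u \<in> verts G \<and> v \<in> verts G \<and> pos u < pos v \<and> lo e = pos u \<and> hi e = pos v"
    if e: "e \<in> edges G" for e
  proof -
    have "card e = 2" "e \<subseteq> verts G" using G e by (auto simp: simple_graph_def)
    then obtain u v where uv: "e = {u, v}" "u \<noteq> v" by (auto simp: card_2_iff)
    with inj \<open>e \<subseteq> verts G\<close> have "pos u \<noteq> pos v" by (auto dest: inj_onD)
    then consider "pos u < pos v" | "pos v < pos u" by linarith
    then show ?thesis
    proof cases
      case 1
      then have "lo e = pos u" "hi e = pos v" by (auto simp: uv lo_def hi_def)
      with 1 uv \<open>e \<subseteq> verts G\<close> show ?thesis by blast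
    next
      case 2
      then have "lo e = pos v" "hi e = pos u" by (auto simp: uv lo_def hi_def)
      with 2 uv \<open>e \<subseteq> verts G\<close> show ?thesis by blast
    qed
  qed
  have lohi: "lo e < hi e" if "e \<in> edges G" for e using edge[OF that] by auto
  have ends: "pt e (lo e) = complex_of_real (lo e)" "pt e (hi e) = complex_of_real (hi e)" for e
    by (auto simp: pt_def complex_eq_iff)
  have ends_im: "ps ` e = {complex_of_real (lo e), complex_of_real (hi e)}" if "e \<in> edges G" for e
    using edge[OF that] by (auto simp: ps_def)
  have image: "path_image (c e) = pt e ` {lo e..hi e}" if "e \<in> edges G" for e
  proof -
    have "c e = pt e \<circ> linepath (lo e) (hi e)" by (auto simp: c_def)
    then have "path_image (c e) = pt e ` path_image (linepath (lo e) (hi e))"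
      by (simp add: path_image_def image_comp)
    then show ?thesis using lohi[OF that]
      by (simp add: closed_segment_eq_real_ivl)
  qed
  have interior: "\<exists>x. lo e < x \<and> x < hi e \<and> z = pt e x \<and> Im z \<noteq> 0"
    if e: "e \<in> edges G" and z: "z \<in> path_image (c e) - ps ` e" for e z
  proof -
    from z image[OF e] obtain x where x: "lo e \<le> x" "x \<le> hi e" "z = pt e x" by auto
    with z ends_im[OF e] ends have "x \<noteq> lo e" "x \<noteq> hi e" by auto
    with x show ?thesis by (intro exI[of _ x]) (auto simp: pt_def sg_def)
  qed
  have "plane_drawing G ps c"
    unfolding plane_drawing_def
  proof (intro conjI ballI impI)
    show "inj_on ps (verts G)" using inj by (auto simp: ps_def inj_on_def)
  next
    fix e assume e: "e \<in> edges G"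
    have "inj (linepath (lo e) (hi e))" if "lo e < hi e"
    proof (rule injI)
      fix a b assume "linepath (lo e) (hi e) a = linepath (lo e) (hi e) b"
      then have "(hi e - lo e) * a = (hi e - lo e) * b" by (simp add: linepath_def algebra_simps)
      with that show "a = b" by simp
    qed
    then have "inj_on (c e) {0..1}"
      using lohi[OF e] by (auto simp: inj_on_def c_def pt_def)
    moreover have "path (c e)"
      unfolding path_def c_def pt_def Complex_eq linepath_def by (intro continuous_intros)
    ultimately show "arc (c e)" by (simp add: arc_def)
    show "{pathstart (c e), pathfinish (c e)} = ps ` e"
      using ends_im[OF e] by (simp add: pathstart_def pathfinish_def c_def linepath_def ends)
    show "(path_image (c e) - ps ` e) \<inter> ps ` verts G = {}"
    proof -
      have "Im z \<noteq> 0" if "z \<in> path_image (c e) - ps ` e" for z using interior[OF e that] by blast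
      moreover have "Im z = 0" if "z \<in> ps ` verts G" for z using that by (auto simp: ps_def)
      ultimately show ?thesis by blast
    qed
  next
    fix e e' assume e: "e \<in> edges G" and e': "e' \<in> edges G" and ne: "e' \<noteq> e"
    show "(path_image (c e) - ps ` e) \<inter> path_image (c e') = {}"
    proof (rule ccontr)
      assume "\<not> ?thesis"
      then obtain z where z: "z \<in> path_image (c e) - ps ` e" "z \<in> path_image (c e')" by auto
      obtain x where x: "lo e < x" "x < hi e" "z = pt e x" "Im z \<noteq> 0"
        using interior[OF e z(1)] by auto
      obtain x' where x': "lo e' \<le> x'" "x' \<le> hi e'" "z = pt e' x'"
        using z(2) image[OF e'] by auto
      have [simp]: "x' = x" using x(3) x'(3) by (simp add: pt_def)
      have in': "lo e' < x" "x < hi e'"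
        using x' x(4) by (auto simp: pt_def order.strict_iff_order)
      define P P' where "P = (x - lo e) * (hi e - x)" and "P' = (x - lo e') * (hi e' - x)"
      have pos: "0 < P" "0 < P'" using x(1,2) in' by (auto simp: P_def P'_def)
      have "sg e * P = sg e' * P'" using x(3) x'(3) by (simp add: pt_def P_def P'_def)
      with pos have same: "e \<in> E \<longleftrightarrow> e' \<in> E" and eq: "P = P'"
        by (auto simp: sg_def split: if_splits)
      obtain u v where uv: "e = {u, v}" "u \<in> verts G" "v \<in> verts G" "lo e = pos u" "hi e = pos v"
        using edge[OF e] by blast
      obtain u' v' where uv': "e' = {u', v'}" "u' \<in> verts G" "v' \<in> verts G"
          "lo e' = pos u'" "hi e' = pos v'"
        using edge[OF e'] by blast
      have nc: "\<not> (lo e < lo e' \<and> lo e' < hi e \<and> hi e < hi e')"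
        "\<not> (lo e' < lo e \<and> lo e < hi e' \<and> hi e' < hi e)"
        using noncrossing[of u v u' v'] noncrossing[of u' v' u v] e e' uv uv' same by auto
      have "lo e \<noteq> lo e' \<or> hi e \<noteq> hi e'"
        using ne uv uv' inj by (auto dest: inj_onD)
      then have "(lo e \<le> lo e' \<and> hi e' \<le> hi e \<and> (lo e < lo e' \<or> hi e' < hi e)) \<or>
        (lo e' \<le> lo e \<and> hi e \<le> hi e' \<and> (lo e' < lo e \<or> hi e < hi e'))"
        using nc x(1,2) in' by linarith
      then have "P \<noteq> P'"
      proof
        assume a: "lo e \<le> lo e' \<and> hi e' \<le> hi e \<and> (lo e < lo e' \<or> hi e' < hi e)"
        have "P' < P"
        proof (cases "lo e < lo e'")
          case True
          then show "P' < P" unfolding P_def P'_def by (intro mult_less_le_imp_less) (use a in' in auto)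
        next
          case False
          then show "P' < P" unfolding P_def P'_def by (intro mult_le_less_imp_less) (use a in' in auto)
        qed
        then show ?thesis by simp
      next
        assume a: "lo e' \<le> lo e \<and> hi e \<le> hi e' \<and> (lo e' < lo e \<or> hi e < hi e')"
        have "P < P'"
        proof (cases "lo e' < lo e")
          case True
          then show "P < P'" unfolding P_def P'_def by (intro mult_less_le_imp_less) (use a x(1,2) in auto)
        next
          case False
          then show "P < P'" unfolding P_def P'_def by (intro mult_le_less_imp_less) (use a x(1,2) in auto)
        qed
        then show ?thesis by simp
      qed
      with eq show False by simp
    qed
  qed
  then show ?thesis by (auto simp: planar_def)
qed

section \<open>Treewidth at most two\<close>

text \<open>Descent to smaller neighbours terminates, and only at \<open>r\<close>.\<close>

lemma connected_graph_if_downward_edges: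
  fixes G :: "nat ugraph"
  assumes r: "r \<in> verts G"
    and down: "\<And>x. x \<in> verts G \<Longrightarrow> x \<noteq> r \<Longrightarrow> \<exists>y\<in>verts G. y < x \<and> {x, y} \<in> edges G"
  shows "connected_graph G"
proof -
  let ?R = "{(x, y). {x, y} \<in> edges G}"
  have "sym ?R" by (auto simp: sym_def insert_commute)
  then have sym: "sym (?R\<^sup>*)" by (rule sym_rtrancl)
  have to_r: "(x, r) \<in> ?R\<^sup>*" if "x \<in> verts G" for x
    using that
  proof (induction x rule: less_induct)
    case (less x)
    show ?case
    proof (cases "x = r")
      case False
      then obtain y where "y \<in> verts G" "y < x" "{x, y} \<in> edges G" using down less.prems by blast
      with less.IH show ?thesis by (auto intro: converse_rtrancl_into_rtrancl)
    qed simp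
  qed
  then show ?thesis
    unfolding connected_graph_def using r sym by (blast intro: rtrancl_trans dest: symD)
qed

definition parent_tree :: "nat set \<Rightarrow> (nat \<Rightarrow> nat) \<Rightarrow> nat ugraph" where
  "parent_tree V p = \<lparr>verts = V, edges = (\<lambda>x. {x, p x}) ` (V - {0})\<rparr>"

text \<open>The largest vertex of a cycle would have its parent as both neighbours on the cycle, but
  these are distinct since the length is at least three.\<close>

lemma is_tree_parent_tree:
  assumes V: "finite V" "0 \<in> V" and p: "\<And>x. x \<in> V \<Longrightarrow> x \<noteq> 0 \<Longrightarrow> p x \<in> V \<and> p x < x"
  shows "is_tree (parent_tree V p)"
proof -
  let ?T = "parent_tree V p"
  have "simple_graph ?T"
    using V p by (force simp: simple_graph_def parent_tree_def card_2_iff)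
  moreover have "connected_graph ?T"
  proof (rule connected_graph_if_downward_edges[of 0])
    fix x assume "x \<in> verts ?T" "x \<noteq> 0"
    then show "\<exists>y\<in>verts ?T. y < x \<and> {x, y} \<in> edges ?T"
      using p by (intro bexI[of _ "p x"]) (auto simp: parent_tree_def)
  qed (use V in \<open>simp add: parent_tree_def\<close>)
  moreover have False if cyc: "is_cycle ?T xs" for xs
  proof -
    have len: "3 \<le> length xs" and dist: "distinct xs"
      and adj: "\<And>i. i < length xs \<Longrightarrow> {xs ! i, xs ! (Suc i mod length xs)} \<in> edges ?T"
      using cyc by (auto simp: is_cycle_def)
    define n where "n = length xs"
    have up: "b = p a" if "{a, b} \<in> edges ?T" "b \<le> a" for a b
      using that p by (fastforce simp: parent_tree_def doubleton_eq_iff)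
    have "Max (set xs) \<in> set xs" using len by (intro Max_in) auto
    then obtain i where i: "i < n" "xs ! i = Max (set xs)" by (auto simp: in_set_conv_nth n_def)
    have le: "xs ! j \<le> xs ! i" if "j < n" for j using that i by (simp add: n_def)
    define j where "j = Suc i mod n"
    define k where "k = (if i = 0 then n - 1 else i - 1)"
    have n3: "3 \<le> n" using len by (simp add: n_def)
    have jk: "j < n" "k < n" "Suc k mod n = i" using n3 i by (auto simp: j_def k_def)
    have "xs ! j = p (xs ! i)" using adj[of i] i le[OF jk(1)] up by (auto simp: n_def j_def)
    moreover have "xs ! k = p (xs ! i)"
      using adj[of k] jk le[OF jk(2)] up by (auto simp: n_def insert_commute)
    ultimately have "j = k" using jk dist by (metis n_def nth_eq_iff_index_eq)
    then show False
      using n3 i by (cases "Suc i = n") (auto simp: j_def k_def split: if_splits)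
  qed
  ultimately show ?thesis by (auto simp: is_tree_def)
qed

text \<open>The decomposition tree is given by \<open>p\<close>, with bags
  \<open>{t, p t, q t}\<close>. By the condition on \<open>q\<close>, a vertex \<open>v\<close> in
  the bag of \<open>x \<noteq> v\<close> is also in the bag of \<open>p x\<close>, so the nodes of
  \<open>v\<close> form a subtree with top \<open>v\<close>.\<close>

lemma treewidth_le_2_if_two_ancestors:
  fixes G :: "nat ugraph"
  assumes V: "finite (verts G)" "0 \<in> verts G"
    and p: "\<And>x. x \<in> verts G \<Longrightarrow> x \<noteq> 0 \<Longrightarrow> p x \<in> verts G \<and> p x < x"
    and q: "\<And>x. x \<in> verts G \<Longrightarrow> x \<noteq> 0 \<Longrightarrow> q x = p x \<or> q x = q (p x)"
    and zero: "p 0 = 0" "q 0 = 0"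
    and E: "\<And>e. e \<in> edges G \<Longrightarrow> \<exists>x\<in>verts G. e \<subseteq> {x, p x, q x}"
  shows "treewidth G \<le> 2"
proof -
  let ?T = "parent_tree (verts G) p"
  let ?B = "\<lambda>t. {t, p t, q t}"
  have pV: "p x \<in> verts G" if "x \<in> verts G" for x using that p zero V by (cases "x = 0") auto
  have qV: "q x \<in> verts G" if "x \<in> verts G" for x
    using that
  proof (induction x rule: less_induct)
    case (less x)
    then show ?case using p q pV zero by (cases "x = 0") force+
  qed
  have "tree_decomposition G ?T ?B"
    unfolding tree_decomposition_def
  proof (intro conjI ballI)
    show "is_tree ?T" using V p by (rule is_tree_parent_tree)
    show "(\<Union>t\<in>verts ?T. ?B t) = verts G" using pV qV by (auto simp: parent_tree_def)
  next
    fix e assume "e \<in> edges G"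
    then show "\<exists>t\<in>verts ?T. e \<subseteq> ?B t" using E by (auto simp: parent_tree_def)
  next
    fix v assume v: "v \<in> verts G"
    let ?S = "{t \<in> verts ?T. v \<in> ?B t}"
    show "connected_graph (induced_subgraph ?T ?S)"
    proof (rule connected_graph_if_downward_edges[of v])
      show "v \<in> verts (induced_subgraph ?T ?S)"
        using v by (simp add: induced_subgraph_def parent_tree_def)
      fix x assume x: "x \<in> verts (induced_subgraph ?T ?S)" "x \<noteq> v"
      then have x': "x \<in> verts G" "v = p x \<or> v = q x"
        by (auto simp: induced_subgraph_def parent_tree_def)
      with x(2) zero have "x \<noteq> 0" by metis
      with x' p q have "p x \<in> verts G" "p x < x" "v = p x \<or> v = q (p x)" by fastforce+
      with x' \<open>x \<noteq> 0\<close> show "\<exists>y\<in>verts (induced_subgraph ?T ?S). y < x \<and> {x, y} \<in> edges (induced_subgraph ?T ?S)"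
        by (intro bexI[of _ "p x"]) (auto simp: induced_subgraph_def parent_tree_def)
    qed
  qed
  moreover have "card (?B t) \<le> 3" for t by (simp add: card_insert_if)
  ultimately have "(LEAST k. \<exists>(T :: nat ugraph) B. tree_decomposition G T B \<and>
     (\<forall>t\<in>verts T. card (B t) \<le> k)) \<le> 3"
    by (intro Least_le) blast
  then show ?thesis by (simp add: treewidth_def)
qed

section \<open>Elimination forests\<close>

definition elimination_forest :: "'a ugraph \<Rightarrow> ('a \<times> 'a) set \<Rightarrow> nat \<Rightarrow> bool" where
  "elimination_forest G P d \<longleftrightarrow> rooted_forest (verts G) P \<and> forest_depth_less (verts G) P d \<and>
     (\<forall>e\<in>edges G. \<exists>u v. e = {u, v} \<and> (u, v) \<in> P\<^sup>+)"

text \<open>A path through all vertices, in the order of an enumeration, is such a forest. Some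
  witness is required for the \<open>LEAST\<close> in \<open>treedepth\<close> to be
  attained.\<close>

lemma elimination_forest_exists:
  assumes G: "simple_graph G"
  shows "\<exists>P d. elimination_forest G P d"
proof -
  define n where "n = card (verts G)"
  have fin: "finite (verts G)" using G by (simp add: simple_graph_def)
  obtain f where f: "bij_betw f (verts G) {0..<n}"
    using ex_bij_betw_finite_nat[OF fin] by (auto simp: n_def)
  have inj: "inj_on f (verts G)" and im: "f ` verts G = {0..<n}" using f by (auto simp: bij_betw_def)
  define P where "P = {(u, v). u \<in> verts G \<and> v \<in> verts G \<and> f u = Suc (f v)}"
  have less: "f v < f u" if "(u, v) \<in> P\<^sup>+" for u v
    using that by (induction rule: trancl_induct) (auto simp: P_def)
  have down: "(u, v) \<in> P ^^ k" if "u \<in> verts G" "v \<in> verts G" "f u = f v + k" for u v k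
    using that
  proof (induction k arbitrary: u)
    case 0
    with inj show ?case by (auto dest: inj_onD)
  next
    case (Suc k)
    have "f u < n" using Suc.prems(1) im by auto
    then have "f v + k \<in> f ` verts G" using Suc.prems(3) im by auto
    then obtain w where w: "w \<in> verts G" "f w = f v + k" by auto
    then have "(w, v) \<in> P ^^ k" using Suc by auto
    moreover have "(u, w) \<in> P" using Suc.prems w by (auto simp: P_def)
    ultimately show ?case by (meson relpow_Suc_I2)
  qed
  have "rooted_forest (verts G) P"
    unfolding rooted_forest_def
  proof (intro conjI)
    show "single_valued P" using inj by (auto simp: single_valued_def P_def dest: inj_onD)
    show "acyclic P" using less by (auto simp: acyclic_def)
  qed (auto simp: P_def)
  moreover have "forest_depth_less (verts G) P n"
    unfolding forest_depth_less_def
  proof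
    fix v assume v: "v \<in> verts G"
    then have "f v < n" using im by auto
    then have "0 \<in> f ` verts G" using im by auto
    then obtain \<rho> where \<rho>: "\<rho> \<in> verts G" "f \<rho> = 0" by auto
    then have "\<rho> \<in> roots (verts G) P" by (auto simp: roots_def P_def)
    with down[OF v \<rho>(1), of "f v"] \<rho> \<open>f v < n\<close> show "\<exists>\<rho>\<in>roots (verts G) P. \<exists>k<n. (v, \<rho>) \<in> P ^^ k" by auto
  qed
  moreover have "\<exists>u v. e = {u, v} \<and> (u, v) \<in> P\<^sup>+" if "e \<in> edges G" for e
  proof -
    have *: "(u, v) \<in> P\<^sup>+" if "u \<in> verts G" "v \<in> verts G" "f v < f u" for u v
    proof -
      have "(u, v) \<in> P ^^ (f u - f v)" using down[of u v "f u - f v"] that by simp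
      with that show ?thesis unfolding trancl_power by (intro exI[of _ "f u - f v"]) simp
    qed
    have "card e = 2" "e \<subseteq> verts G" using G that by (auto simp: simple_graph_def)
    then obtain u v where uv: "e = {u, v}" "u \<noteq> v" by (auto simp: card_2_iff)
    with \<open>e \<subseteq> verts G\<close> have V: "u \<in> verts G" "v \<in> verts G" by auto
    with uv inj have "f u \<noteq> f v" by (auto dest: inj_onD)
    then consider "f u < f v" | "f v < f u" by linarith
    then show ?thesis
    proof cases
      case 1
      then show ?thesis using *[OF V(2,1)] uv(1) by blast
    next
      case 2
      then show ?thesis using *[OF V] uv(1) by blast
    qed
  qed
  ultimately show ?thesis unfolding elimination_forest_def by blast
qed

lemma elimination_forest_treedepth:
  assumes "simple_graph G"
  obtains P where "elimination_forest G P (treedepth G)"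
proof -
  have "\<exists>d P. elimination_forest G P d" using elimination_forest_exists[OF assms] by blast
  then have "\<exists>P. elimination_forest G P (LEAST d. \<exists>P. elimination_forest G P d)" by (rule LeastI_ex)
  then show thesis using that unfolding treedepth_def elimination_forest_def by blast
qed

text \<open>Parents are unique, so the proper ancestors of \<open>v\<close> are the vertices met on
  the way to the root. Their number can then serve as depth.\<close>

lemma card_ancestors_le:
  assumes "single_valued P" "(v, \<rho>) \<in> P ^^ k" "\<rho> \<notin> Domain P"
  shows "finite (P\<^sup>+ `` {v}) \<and> card (P\<^sup>+ `` {v}) \<le> k"
  using assms(2)
proof (induction k arbitrary: v)
  case 0
  then have "P\<^sup>+ `` {v} = {}" using assms(3) by (auto dest: tranclD)
  then show ?case by simp
next
  case (Suc k)
  then obtain w where w: "(v, w) \<in> P" "(w, \<rho>) \<in> P ^^ k" by (meson relpow_Suc_E2)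
  have "P\<^sup>+ `` {v} = insert w (P\<^sup>+ `` {w})"
  proof
    show "P\<^sup>+ `` {v} \<subseteq> insert w (P\<^sup>+ `` {w})"
    proof
      fix x assume "x \<in> P\<^sup>+ `` {v}"
      then obtain y where y: "(v, y) \<in> P" "(y, x) \<in> P\<^sup>*" by (auto dest: tranclD)
      with w assms(1) have "y = w" by (auto simp: single_valued_def)
      with y show "x \<in> insert w (P\<^sup>+ `` {w})" by (auto simp: rtrancl_eq_or_trancl)
    qed
  qed (use w in \<open>auto intro: trancl_into_trancl2\<close>)
  with Suc.IH[OF w(2)] show ?case by (auto simp: card_insert_if)
qed

text \<open>
  The rank of a connected set is the number of levels of the forest from its topmost vertex down;
  that vertex is unique, and so lies in at most one of two disjoint subsets.
\<close>

lemma elimination_rank: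
  assumes P: "elimination_forest H P d"
  obtains rank :: "'a set \<Rightarrow> nat" where
    "\<And>S. rank S \<le> d"
    "\<And>S S'. S \<noteq> {} \<Longrightarrow> S \<subseteq> S' \<Longrightarrow> rank S \<le> rank S'"
    "\<And>S S1 S2. S \<subseteq> verts H \<Longrightarrow> connected_graph (induced_subgraph H S) \<Longrightarrow>
       S1 \<subseteq> S \<Longrightarrow> S2 \<subseteq> S \<Longrightarrow> S1 \<noteq> {} \<Longrightarrow> S2 \<noteq> {} \<Longrightarrow> S1 \<inter> S2 = {} \<Longrightarrow>
       rank S1 < rank S \<or> rank S2 < rank S"
proof
  let ?dep = "\<lambda>v. card (P\<^sup>+ `` {v})"
  \<comment> \<open>The depth of a topmost vertex of \<open>S\<close>; for empty \<open>S\<close>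
    the value is unspecified. The rank will be \<open>d - level S\<close>.\<close>
  define level where "level S = (LEAST k. k \<in> ?dep ` S)" for S
  have sv: "single_valued P" and ac: "acyclic P"
    using P by (auto simp: elimination_forest_def rooted_forest_def)
  have dep: "finite (P\<^sup>+ `` {v})" "?dep v < d" if "v \<in> verts H" for v
  proof -
    obtain \<rho> k where "\<rho> \<in> roots (verts H) P" "k < d" "(v, \<rho>) \<in> P ^^ k"
      using P \<open>v \<in> verts H\<close> by (auto simp: elimination_forest_def forest_depth_less_def)
    with card_ancestors_le[OF sv, of v \<rho> k] show "finite (P\<^sup>+ `` {v})" "?dep v < d"
      by (auto simp: roots_def)
  qed
  have less: "?dep u < ?dep v" if "v \<in> verts H" "(v, u) \<in> P\<^sup>+" for u v
  proof (rule psubset_card_mono)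
    show "P\<^sup>+ `` {u} \<subset> P\<^sup>+ `` {v}"
      using that ac by (auto simp: acyclic_def intro: trancl_trans)
  qed (use dep that in auto)
  have level_le: "level S \<le> ?dep v" if "v \<in> S" for S v
    unfolding level_def using that by (intro Least_le) auto
  have level_in: "\<exists>v\<in>S. level S = ?dep v" if "S \<noteq> {}" for S
  proof -
    have "\<exists>k. k \<in> ?dep ` S" using that by blast
    then have "level S \<in> ?dep ` S" unfolding level_def by (rule LeastI_ex)
    then show ?thesis by auto
  qed
  show "d - level S \<le> d" for S by simp
  show "d - level S \<le> d - level S'" if ne: "S \<noteq> {}" and sub: "S \<subseteq> S'" for S S'
  proof -
    obtain v where "v \<in> S" "level S = ?dep v" using level_in[OF ne] by blast
    with level_le[of v S'] sub have "level S' \<le> level S" by auto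
    then show ?thesis by (rule diff_le_mono2)
  qed
  fix S S1 S2
  assume S: "S \<subseteq> verts H" and con: "connected_graph (induced_subgraph H S)"
    and sub: "S1 \<subseteq> S" "S2 \<subseteq> S" and ne: "S1 \<noteq> {}" "S2 \<noteq> {}" and disj: "S1 \<inter> S2 = {}"
  obtain m where m: "m \<in> S" "level S = ?dep m"
    using level_in[of S] ne sub by blast
  \<comment> \<open>Edges join comparable vertices, so along a walk inside \<open>S\<close> the
    current vertex stays comparable to \<open>m\<close>, and it never gets above \<open>m\<close>,
    which has least depth in \<open>S\<close>.\<close>
  have top: "(x, m) \<in> P\<^sup>*" if "x \<in> S" for x
  proof -
    have "(m, x) \<in> {(x, y). {x, y} \<in> edges (induced_subgraph H S)}\<^sup>*"
      using con m(1) that by (auto simp: connected_graph_def induced_subgraph_def)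
    then show ?thesis
    proof (induction rule: rtrancl_induct)
      case (step x y)
      then have xy: "{x, y} \<in> edges H" "x \<in> S" "y \<in> S" by (auto simp: induced_subgraph_def)
      then obtain u v where "{x, y} = {u, v}" "(u, v) \<in> P\<^sup>+"
        using P by (auto simp: elimination_forest_def)
      then consider "(y, x) \<in> P\<^sup>+" | "(x, y) \<in> P\<^sup>+" by (auto simp: doubleton_eq_iff)
      then show ?case
      proof cases
        case 2
        then have "(y, m) \<in> P\<^sup>* \<or> (m, y) \<in> P\<^sup>*"
          using single_valued_confluent[OF sv step.IH] by (auto dest: trancl_into_rtrancl)
        moreover have "(m, y) \<notin> P\<^sup>+"
          using less[of m y] m level_le[OF xy(3)] S by auto
        ultimately show ?thesis by (auto simp: rtrancl_eq_or_trancl)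
      qed (use step.IH in \<open>auto dest: trancl_into_rtrancl intro: rtrancl_trans\<close>)
    qed simp
  qed
  have lt: "level S < level S'" if "S' \<subseteq> S" "S' \<noteq> {}" "m \<notin> S'" for S'
  proof -
    obtain x where x: "x \<in> S'" "level S' = ?dep x" using level_in[OF \<open>S' \<noteq> {}\<close>] by auto
    with that top[of x] have "(x, m) \<in> P\<^sup>+" by (auto simp: rtrancl_eq_or_trancl)
    with less[of x m] x m that S show ?thesis by auto
  qed
  \<comment> \<open>This keeps the truncated difference \<open>d - level S\<close> positive, so that
    a larger level gives a strictly smaller rank.\<close>
  have "level S < d" using m S dep by auto
  moreover have "level S < level S1 \<or> level S < level S2" using lt sub ne disj by blast
  ultimately show "d - level S1 < d - level S \<or> d - level S2 < d - level S" by auto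
qed

section \<open>Components of induced subgraphs\<close>

text \<open>For \<open>u\<close> in \<open>A\<close> this is the component of \<open>u\<close> in
  the subgraph induced by \<open>A\<close>; for other \<open>u\<close> it is \<open>{u}\<close>, so
  it is never empty.\<close>

definition reach :: "'a ugraph \<Rightarrow> 'a set \<Rightarrow> 'a \<Rightarrow> 'a set" where
  "reach G A u = {v. (u, v) \<in> {(x, y). {x, y} \<in> edges G \<and> {x, y} \<subseteq> A}\<^sup>*}"

lemma reach_self: "u \<in> reach G A u"
  by (simp add: reach_def)

lemma reach_subset: "u \<in> A \<Longrightarrow> reach G A u \<subseteq> A"
  by (auto simp: reach_def elim: rtranclE)

lemma reach_subset_reach:
  assumes "A \<subseteq> B" "u \<in> A" "v \<in> B" "{v, u} \<in> edges G"
  shows "reach G A u \<subseteq> reach G B v"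
proof
  fix x assume "x \<in> reach G A u"
  then have "(u, x) \<in> {(x, y). {x, y} \<in> edges G \<and> {x, y} \<subseteq> B}\<^sup>*"
    unfolding reach_def using assms(1) by (auto elim!: rtrancl_mono[THEN subsetD, rotated])
  moreover have "(v, u) \<in> {(x, y). {x, y} \<in> edges G \<and> {x, y} \<subseteq> B}" using assms by auto
  ultimately show "x \<in> reach G B v" unfolding reach_def by (auto intro: converse_rtrancl_into_rtrancl)
qed

lemma connected_reach:
  assumes "reach G A u \<subseteq> V"
  shows "connected_graph (induced_subgraph (induced_subgraph G V) (reach G A u))"
proof -
  let ?S = "reach G A u"
  let ?R = "{(x, y). {x, y} \<in> edges (induced_subgraph (induced_subgraph G V) ?S)}"
  have "sym ?R" by (auto simp: sym_def insert_commute)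
  then have sym: "sym (?R\<^sup>*)" by (rule sym_rtrancl)
  have "(u, x) \<in> ?R\<^sup>*" if "x \<in> ?S" for x
  proof -
    have "(u, x) \<in> {(x, y). {x, y} \<in> edges G \<and> {x, y} \<subseteq> A}\<^sup>*" using that by (simp add: reach_def)
    then show ?thesis
    proof (induction rule: rtrancl_induct)
      case (step y z)
      then have "y \<in> ?S" "z \<in> ?S" by (auto simp: reach_def intro: rtrancl_into_rtrancl)
      with step assms have "(y, z) \<in> ?R" by (auto simp: induced_subgraph_def)
      with step.IH show ?case by (rule rtrancl_into_rtrancl)
    qed simp
  qed
  then show ?thesis
    unfolding connected_graph_def using sym reach_self[of u G A]
    by (auto simp: induced_subgraph_def intro: rtrancl_trans dest: symD)
qed

section \<open>Random branches\<close>

definition words :: "nat \<Rightarrow> nat \<Rightarrow> nat list set" where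
  "words b n = {x. set x \<subseteq> {..<b} \<and> length x = n}"

text \<open>
  Words are written with the newest letter first, so \<open>tl x\<close> is the parent of \<open>x\<close>. The letter \<open>0\<close> opens
  a new tree, all of whose vertices are joined to the word preceding that \<open>0\<close>. The outermost
  tree has no such letter and is joined to \<open>[]\<close>, which is then its own apex.
\<close>

definition apex :: "nat list \<Rightarrow> nat list" where
  "apex x = tl (dropWhile (\<lambda>c. c \<noteq> 0) x)"

lemma apex_simps [simp]:
  "apex [] = []" "apex (0 # x) = x" "c \<noteq> 0 \<Longrightarrow> apex (c # x) = apex x"
  by (auto simp: apex_def)

lemma apex_cases: "apex x = tl x \<or> apex x = apex (tl x)"
  by (cases x) (auto simp: apex_def)

lemma suffix_apex: "suffix (apex x) x"
proof (induction x)
  case (Cons c x)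
  then show ?case by (cases "c = 0") (auto simp: suffix_ConsI)
qed simp

text \<open>Cutting at the newest \<open>0\<close> isolates \<open>w\<close>, the letters read since
  the current tree was opened. The second case is the outermost tree, which no \<open>0\<close>
  opens.\<close>

lemma apex_decomp:
  "(\<exists>w. x = w @ 0 # apex x \<and> 0 \<notin> set w) \<or> (0 \<notin> set x \<and> apex x = [])"
proof (induction x)
  case (Cons c x)
  consider "c = 0" | "c \<noteq> 0" "\<exists>w. x = w @ 0 # apex x \<and> 0 \<notin> set w"
    | "c \<noteq> 0" "0 \<notin> set x" "apex x = []"
    using Cons.IH by blast
  then show ?case
  proof cases
    case 2
    then obtain w where "x = w @ 0 # apex x" "0 \<notin> set w" by blast
    with 2 have "c # x = (c # w) @ 0 # apex (c # x) \<and> 0 \<notin> set (c # w)" by simp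
    then show ?thesis by blast
  qed auto
qed simp

lemma finite_words [simp]: "finite (words b n)"
  unfolding words_def by (rule finite_lists_length_eq) simp

lemma card_words: "card (words b n) = b ^ n"
  unfolding words_def by (subst card_lists_length_eq) auto

lemma sum_words_Suc: "(\<Sum>y\<in>words b (Suc n). f y) = (\<Sum>x\<in>words b n. \<Sum>c<b. f (c # x))"
proof -
  have "words b (Suc n) = (\<lambda>(x, c). c # x) ` (words b n \<times> {..<b})"
    by (auto simp: words_def length_Suc_conv image_iff)
  moreover have "inj_on (\<lambda>(x, c). c # x) (words b n \<times> {..<b})" by (auto simp: inj_on_def)
  ultimately show ?thesis
    by (simp add: sum.reindex sum.cartesian_product case_prod_unfold)
qed

text \<open>
  \<open>D\<close> is the set of deleted words and \<open>g\<close> bounds treedepth. The first summand of the potential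
  records how much the rank has dropped on entering the current tree, the second, capped at \<open>s\<close>,
  how much it has dropped inside that tree.
\<close>

definition apex_rank :: "nat \<Rightarrow> (nat list \<Rightarrow> nat) \<Rightarrow> nat list set \<Rightarrow> nat list \<Rightarrow> nat" where
  "apex_rank M g D x = (if apex x \<in> D then M else g (apex x))"

definition potential :: "nat \<Rightarrow> nat \<Rightarrow> (nat list \<Rightarrow> nat) \<Rightarrow> nat list set \<Rightarrow> nat list \<Rightarrow> nat" where
  "potential M s g D x =
     2 * (M - apex_rank M g D x) + (if x \<in> D then s else min s (apex_rank M g D x - g x))"

text \<open>
  Each step down to a random letter gains at least \<open>1/2\<close> in expected potential, unless it
  starts in a deleted word, which loses \<open>O(s)\<close>. Everything is multiplied by \<open>2 * s\<close> to stay in the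
  natural numbers.
\<close>

lemma potential_step:
  assumes s: "2 \<le> s" and M: "M = s\<^sup>2" and le: "\<And>y. g y \<le> M"
    and child: "\<And>c. c < 2 * s \<Longrightarrow> x \<notin> D \<Longrightarrow> c # x \<notin> D \<Longrightarrow> g (c # x) \<le> g x"
    and siblings: "\<And>c c'. c < 2 * s \<Longrightarrow> c' < 2 * s \<Longrightarrow> c \<noteq> c' \<Longrightarrow> x \<notin> D \<Longrightarrow> c # x \<notin> D \<Longrightarrow>
      c' # x \<notin> D \<Longrightarrow> g (c # x) < g x \<or> g (c' # x) < g x"
    and apex: "x \<notin> D \<Longrightarrow> apex x \<notin> D \<Longrightarrow> g x \<le> g (apex x)"
  shows "2 * s * potential M s g D x + s \<le>
    (if x \<in> D then 4 * s\<^sup>2 + s else 0) + (\<Sum>c<2 * s. potential M s g D (c # x))"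
proof -
  let ?V = "potential M s g D"
  define t where "t = apex_rank M g D x"
  define A where "A = 2 * (M - t)"
  have t: "t \<le> M" using le by (simp add: t_def apex_rank_def)
  \<comment> \<open>Only the letter \<open>0\<close> changes the apex, so its child is treated
    apart.\<close>
  have split: "(\<Sum>c<2 * s. ?V (c # x)) = ?V (0 # x) + (\<Sum>c\<in>{1..<2 * s}. ?V (c # x))"
  proof -
    have "{..<2 * s} = insert 0 {1..<2 * s}" using s by auto
    then show ?thesis by simp
  qed
  have rank_child: "apex_rank M g D (c # x) = t" if "c \<noteq> 0" for c
    using that by (simp add: apex_rank_def t_def)
  have lower: "(2 * s - 1) * k \<le> (\<Sum>c\<in>{1..<2 * s}. f c)" if "\<And>c. c \<in> {1..<2 * s} \<Longrightarrow> k \<le> f c"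
    for k :: nat and f
    using sum_mono[of "{1..<2 * s}" "\<lambda>_. k" f] that by simp
  have pred: "(2 * s - 1) * k + k = 2 * s * k" for k
    using s by (cases s) (auto simp: algebra_simps)
  show ?thesis
  proof (cases "x \<in> D")
    case True
    \<comment> \<open>The credit \<open>4 * s\<^sup>2\<close> pays for the summand \<open>s\<close>,
      counted \<open>2 * s\<close> times, and for ignoring the child \<open>0\<close>, which costs
      \<open>A\<close>, at most \<open>2 * s\<^sup>2\<close>.\<close>
    have "(2 * s - 1) * A \<le> (\<Sum>c\<in>{1..<2 * s}. ?V (c # x))"
      using rank_child by (intro lower) (simp add: potential_def A_def)
    moreover have "?V x = A + s" using True by (simp add: potential_def A_def t_def)
    moreover have "A \<le> 2 * s\<^sup>2" using M by (simp add: A_def)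
    moreover note pred[of A]
    ultimately show ?thesis
      unfolding split using True by (simp add: algebra_simps power2_eq_square)
  next
    case False
    define h where "h = t - g x"
    have gt: "g x \<le> t" using apex False le by (simp add: t_def apex_rank_def)
    have V: "?V x = A + min s h" using False by (simp add: potential_def A_def t_def h_def)
    \<comment> \<open>The apex of \<open>0 # x\<close> is \<open>x\<close>, so the drop
      \<open>h\<close> inside the old tree moves to the first summand, where it counts
      twice.\<close>
    have V0: "A + 2 * h \<le> ?V (0 # x)"
      using False t gt by (simp add: potential_def apex_rank_def A_def h_def)
    show ?thesis
    proof (cases "s \<le> h")
      case True
      \<comment> \<open>The other children keep the capped value; the gain comes from the child
        \<open>0\<close>, which exceeds \<open>A + s\<close> by at least \<open>s\<close>.\<close>
      have "(2 * s - 1) * (A + s) \<le> (\<Sum>c\<in>{1..<2 * s}. ?V (c # x))"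
      proof (rule lower)
        fix c assume "c \<in> {1..<2 * s}"
        then show "A + s \<le> ?V (c # x)"
          using rank_child[of c] child[of c] False True by (auto simp: potential_def A_def h_def)
      qed
      with pred[of "A + s"] V V0 True False show ?thesis by (simp add: split)
    next
      case less: False
      \<comment> \<open>Only one child can fail to decrease the rank; it costs the \<open>1\<close> subtracted below.\<close>
      obtain c0 where c0: "\<And>c. c < 2 * s \<Longrightarrow> c \<noteq> c0 \<Longrightarrow> c # x \<notin> D \<Longrightarrow> g (c # x) < g x"
        using siblings False by metis
      have "(2 * s - 1) * (A + h + 1) \<le>
          (\<Sum>c\<in>{1..<2 * s}. ?V (c # x) + (if c = c0 then 1 else 0))"
      proof (rule lower)
        fix c assume "c \<in> {1..<2 * s}"
        then show "A + h + 1 \<le> ?V (c # x) + (if c = c0 then 1 else 0)"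
          using rank_child[of c] child[of c] c0[of c] False less gt
          by (auto simp: potential_def A_def h_def)
      qed
      also have "\<dots> \<le> (\<Sum>c\<in>{1..<2 * s}. ?V (c # x)) + 1"
        by (simp add: sum.distrib)
      finally have "(2 * s - 1) * (A + h + 1) \<le> (\<Sum>c\<in>{1..<2 * s}. ?V (c # x)) + 1" .
      moreover have "2 * s * (A + h + 1) = 2 * s * (A + h) + 2 * s" by simp
      \<comment> \<open>The surplus over \<open>2 * s * (A + h)\<close> is at least
        \<open>2 * s - 2 + h\<close>, which is at least \<open>s\<close> since
        \<open>2 \<le> s\<close>.\<close>
      ultimately show ?thesis
        using pred[of "A + h + 1"] V V0 less False s by (simp add: split)
    qed
  qed
qed

section \<open>Telescoping along the branch and averaging over the distribution\<close>

text \<open>Divided by \<open>2 * s\<close> times the number of words of length \<open>n\<close>,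
  the sum of \<open>step\<close> over these words relates the means \<open>e n\<close> of the
  potential to the probabilities \<open>d n\<close> that a random word of length \<open>n\<close> is
  deleted. Summing over \<open>n\<close> telescopes; the final constant bounds the
  potential.\<close>

lemma weight_lower_bound:
  assumes s: "2 \<le> s" and M: "M = s\<^sup>2"
    and step: "\<And>n x. n < N \<Longrightarrow> x \<in> words (2 * s) n \<Longrightarrow>
      2 * s * potential M s g D x + s \<le>
        (if x \<in> D then 4 * s\<^sup>2 + s else 0) + (\<Sum>c<2 * s. potential M s g D (c # x))"
  shows "real N / 2 \<le> (2 * real s + 1 / 2) *
      (\<Sum>n<N. \<Sum>x\<in>words (2 * s) n. if x \<in> D then 1 / real (2 * s) ^ n else 0) +
      (2 * (real s)\<^sup>2 + real s)"
proof -
  let ?b = "2 * s"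
  let ?V = "potential M s g D"
  define e where "e n = (\<Sum>x\<in>words ?b n. real (?V x)) / real ?b ^ n" for n
  define d where "d n = (\<Sum>x\<in>words ?b n. if x \<in> D then 1 / real ?b ^ n else 0)" for n
  have d_eq: "(\<Sum>x\<in>words ?b n. if x \<in> D then k else 0) = k * real ?b ^ n * d n" for n and k :: real
    using s unfolding d_def sum_distrib_left by (intro sum.cong) auto
  have e_step: "e n + 1 / 2 \<le> (2 * real s + 1 / 2) * d n + e (Suc n)" if n: "n < N" for n
  proof -
    have "2 * real s * real (?V x) + real s \<le>
        (if x \<in> D then 4 * (real s)\<^sup>2 + real s else 0) + (\<Sum>c<2 * s. real (?V (c # x)))"
      if "x \<in> words ?b n" for x
      using of_nat_mono[OF step[OF n that], where 'a = real] by (cases "x \<in> D") simp_all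
    then have "(\<Sum>x\<in>words ?b n. 2 * real s * real (?V x) + real s) \<le>
        (\<Sum>x\<in>words ?b n. (if x \<in> D then 4 * (real s)\<^sup>2 + real s else 0) +
           (\<Sum>c<2 * s. real (?V (c # x))))"
      by (rule sum_mono)
    then have "2 * real s * (\<Sum>x\<in>words ?b n. real (?V x)) + real ?b ^ n * real s \<le>
        (4 * (real s)\<^sup>2 + real s) * real ?b ^ n * d n + (\<Sum>x\<in>words ?b (Suc n). real (?V x))"
      by (simp add: sum.distrib sum_distrib_left card_words sum_words_Suc d_eq)
    moreover have "(\<Sum>x\<in>words ?b n. real (?V x)) = real ?b ^ n * e n"
      "(\<Sum>x\<in>words ?b (Suc n). real (?V x)) = real ?b ^ n * (2 * real s * e (Suc n))"
      using s by (auto simp: e_def)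
    ultimately have "real ?b ^ n * (2 * real s * (e n + 1 / 2)) \<le>
        real ?b ^ n * (2 * real s * ((2 * real s + 1 / 2) * d n + e (Suc n)))"
      by (simp add: algebra_simps power2_eq_square)
    with s show ?thesis by simp
  qed
  have sum: "e 0 + real k / 2 \<le> (2 * real s + 1 / 2) * (\<Sum>n<k. d n) + e k" if "k \<le> N" for k
    using that
  proof (induction k)
    case (Suc k)
    with e_step[of k] show ?case by (simp add: algebra_simps add_divide_distrib)
  qed simp
  have "real (?V x) \<le> 2 * (real s)\<^sup>2 + real s" for x
  proof -
    have "?V x \<le> 2 * s\<^sup>2 + s" using M by (auto simp: potential_def)
    then have "real (?V x) \<le> real (2 * s\<^sup>2 + s)" by (rule of_nat_mono)
    then show ?thesis by simp
  qed
  then have "(\<Sum>x\<in>words ?b N. real (?V x)) \<le> real ?b ^ N * (2 * (real s)\<^sup>2 + real s)"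
    using sum_mono[of "words ?b N" "\<lambda>x. real (?V x)" "\<lambda>_. 2 * (real s)\<^sup>2 + real s"]
    by (simp add: card_words)
  then have "e N \<le> 2 * (real s)\<^sup>2 + real s"
    using s by (simp add: e_def divide_le_eq mult.commute)
  moreover have "0 \<le> e 0" by (simp add: e_def sum_nonneg)
  ultimately show ?thesis using sum[of N] by (simp add: d_def)
qed

text \<open>Every set in the support captures weight at least \<open>c\<close>, hence so does the
  average, which by linearity is at most \<epsilon> times the total weight.\<close>

lemma thin_weight_le:
  assumes p: "thin \<epsilon> V p" and V: "finite V" and v: "\<And>i. i \<in> I \<Longrightarrow> v i \<in> V"
    and w: "\<And>i. i \<in> I \<Longrightarrow> 0 \<le> w i"
    and c: "\<And>Y. Y \<in> set_pmf p \<Longrightarrow> c \<le> (\<Sum>i\<in>I. if v i \<in> Y then w i else 0)"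
  shows "c \<le> \<epsilon> * (\<Sum>i\<in>I. w i)"
proof -
  have fin: "finite (set_pmf p)" using p V by (auto simp: thin_def intro: finite_subset)
  have int: "integrable (measure_pmf p) f" for f :: "'a set \<Rightarrow> real"
    using fin by (rule integrable_measure_pmf_finite)
  have "(\<Sum>i\<in>I. if v i \<in> Y then w i else 0) = (\<Sum>i\<in>I. w i * indicator {Y. v i \<in> Y} Y)" for Y
    by (intro sum.cong) auto
  with c have "c \<le> measure_pmf.expectation p (\<lambda>Y. \<Sum>i\<in>I. w i * indicator {Y. v i \<in> Y} Y)"
    by (intro measure_pmf.integral_ge_const int) (auto simp: AE_measure_pmf_iff)
  also have "\<dots> = (\<Sum>i\<in>I. w i * measure_pmf.prob p {Y. v i \<in> Y})"
    by (subst Bochner_Integration.integral_sum) (auto intro!: int)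
  also have "\<dots> \<le> (\<Sum>i\<in>I. w i * \<epsilon>)"
    using p v w by (intro sum_mono mult_left_mono) (auto simp: thin_def)
  also have "\<dots> = \<epsilon> * (\<Sum>i\<in>I. w i)" by (simp add: sum_distrib_left mult.commute)
  finally show ?thesis .
qed

section \<open>Nested fans\<close>

text \<open>Comparison with both bounds fixes the letters of \<open>u\<close> one by one. In
  preorder terms, the descendants of \<open>u\<close> are contiguous.\<close>

lemma prefix_order_between:
  fixes u v y :: "'a :: linorder list"
  assumes "u < v" "v < u @ y"
  shows "\<exists>z. v = u @ z \<and> z \<noteq> [] \<and> z < y"
  using assms
proof (induction u arbitrary: v)
  case (Cons a u)
  then show ?case by (cases v) auto
qed auto

lemma append_less_append_iff: "u @ y < u @ z \<longleftrightarrow> y < (z :: 'a :: linorder list)"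
  by (induction u) auto

text \<open>In the next two lemmas words are written root first, so that the list order is preorder.\<close>

lemma parent_edges_noncrossing:
  fixes u v :: "nat list"
  assumes "u < v" "v < u @ [c]"
  shows "v @ [d] < u @ [c]"
proof -
  obtain z where z: "v = u @ z" "z \<noteq> []" "z < [c]" using prefix_order_between[OF assms] by blast
  \<comment> \<open>From \<open>z < [c]\<close> the letter \<open>e\<close> is below
    \<open>c\<close>, so the whole subtree of \<open>u @ [e]\<close> precedes
    \<open>u @ [c]\<close>.\<close>
  then obtain e z' where "z = e # z'" by (cases z) auto
  with z show ?thesis by (auto simp: append_less_append_iff)
qed

lemma apex_edges_noncrossing:
  fixes u v :: "nat list"
  assumes uv: "u < v" "v < u @ y" "u @ y < v @ 0 # w'"
    and y: "y = 0 # w \<or> y = w" and w: "0 \<notin> set w"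
  shows False
proof -
  \<comment> \<open>Otherwise \<open>w\<close> would run through \<open>z\<close> and continue with
    the letter \<open>0\<close>.\<close>
  have no: False if less: "z < w" "w < z @ 0 # w'" for z
  proof -
    obtain z2 where z2: "w = z @ z2" "z2 \<noteq> []" "z2 < 0 # w'"
      using prefix_order_between[OF less] by blast
    then have "hd z2 = 0" "hd z2 \<in> set w" by (cases z2; auto)+
    with w show False by simp
  qed
  obtain z where z: "v = u @ z" "z \<noteq> []" "z < y" using prefix_order_between[OF uv(1,2)] by blast
  with uv(3) have yz: "y < z @ 0 # w'" by (simp add: append_less_append_iff)
  \<comment> \<open>An apex edge joins \<open>u\<close> to \<open>u @ 0 # w\<close>, except in the
    outermost tree, where no \<open>0\<close> precedes \<open>w\<close>.\<close>
  from y show False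
  proof
    assume "y = 0 # w"
    moreover from this z obtain z1 where "z = 0 # z1" by (cases z) auto
    ultimately show False using z yz no[of z1] by simp
  qed (use z yz no in blast)
qed

definition words_upto :: "nat \<Rightarrow> nat \<Rightarrow> nat list set" where
  "words_upto b N = {x. set x \<subseteq> {..<b} \<and> length x \<le> N}"

text \<open>Encoding makes the vertices natural numbers, with parents smaller than children. The
  word \<open>[]\<close> is its own \<open>tl\<close> and \<open>apex\<close> and would give a
  singleton edge, hence \<open>x \<noteq> []\<close>.\<close>

definition nested_fans :: "nat \<Rightarrow> nat \<Rightarrow> nat ugraph" where
  "nested_fans b N =
     \<lparr>verts = list_encode ` words_upto b N,
      edges = {{list_encode x, list_encode y} | x y.
        x \<in> words_upto b N \<and> x \<noteq> [] \<and> (y = tl x \<or> y = apex x)}\<rparr>"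

lemma finite_words_upto: "finite (words_upto b N)"
  unfolding words_upto_def by (rule finite_lists_length_le) simp

lemma verts_nested_fans: "verts (nested_fans b N) = list_encode ` words_upto b N"
  by (simp add: nested_fans_def)

lemma edges_nested_fans: "edges (nested_fans b N) =
    {{list_encode x, list_encode y} | x y.
      x \<in> words_upto b N \<and> x \<noteq> [] \<and> (y = tl x \<or> y = apex x)}"
  by (simp add: nested_fans_def)

lemma suffix_in_words_upto: "x \<in> words_upto b N \<Longrightarrow> suffix y x \<Longrightarrow> y \<in> words_upto b N"
  by (auto simp: words_upto_def dest: set_mono_suffix suffix_length_le)

lemma list_encode_tl_less: "x \<noteq> [] \<Longrightarrow> list_encode (tl x) < list_encode x"
  by (cases x) (auto simp: less_Suc_eq_le le_prod_encode_2)

lemma suffix_if_tl_or_apex: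
  assumes "x \<noteq> []" "y = tl x \<or> y = apex x"
  shows "suffix y x" "y \<noteq> x"
proof -
  have "suffix (apex x) (tl x)"
    using assms(1) apex_cases[of x] suffix_apex[of "tl x"] by auto
  with assms show "suffix y x" by (auto simp: suffix_tl suffix_apex)
  have "length (apex x) \<le> length (tl x)" using \<open>suffix (apex x) (tl x)\<close> by (rule suffix_length_le)
  with assms(1) have "length (apex x) < length x" "length (tl x) < length x" by (cases x; simp)+
  with assms(2) show "y \<noteq> x" by (metis less_irrefl)
qed

lemma simple_graph_nested_fans: "simple_graph (nested_fans b N)"
  unfolding simple_graph_def
proof (intro conjI ballI)
  show "finite (verts (nested_fans b N))" by (simp add: verts_nested_fans finite_words_upto)
  fix e assume "e \<in> edges (nested_fans b N)"
  then obtain x y where e: "e = {list_encode x, list_encode y}" "x \<in> words_upto b N" "x \<noteq> []"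
      "y = tl x \<or> y = apex x"
    by (auto simp: edges_nested_fans)
  have "suffix y x" "y \<noteq> x" using suffix_if_tl_or_apex[OF e(3,4)] by auto
  moreover from e(2) this(1) have "y \<in> words_upto b N" by (rule suffix_in_words_upto)
  ultimately show "e \<subseteq> verts (nested_fans b N)" "card e = 2" using e
    by (auto simp: verts_nested_fans list_encode_eq)
qed

lemma treewidth_nested_fans: "treewidth (nested_fans b N) \<le> 2"
proof (rule treewidth_le_2_if_two_ancestors[where
    p = "\<lambda>n. list_encode (tl (list_decode n))" and q = "\<lambda>n. list_encode (apex (list_decode n))"])
  show "finite (verts (nested_fans b N))"
    using simple_graph_nested_fans by (simp add: simple_graph_def)
  have "[] \<in> words_upto b N" by (simp add: words_upto_def)
  then show "0 \<in> verts (nested_fans b N)" by (force simp: verts_nested_fans)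
  fix n assume n: "n \<in> verts (nested_fans b N)" "n \<noteq> 0"
  then obtain x where nx: "n = list_encode x" "x \<in> words_upto b N" by (auto simp: verts_nested_fans)
  with n(2) have x: "n = list_encode x" "x \<in> words_upto b N" "x \<noteq> []" by auto
  then have "tl x \<in> words_upto b N" using suffix_in_words_upto[OF _ suffix_tl] by simp
  with x show "list_encode (tl (list_decode n)) \<in> verts (nested_fans b N) \<and>
      list_encode (tl (list_decode n)) < n"
    by (auto simp: verts_nested_fans list_encode_tl_less)
  show "list_encode (apex (list_decode n)) = list_encode (tl (list_decode n)) \<or>
      list_encode (apex (list_decode n)) =
      list_encode (apex (list_decode (list_encode (tl (list_decode n)))))"
    using apex_cases[of "list_decode n"] by auto
next
  fix e assume "e \<in> edges (nested_fans b N)"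
  then show "\<exists>n\<in>verts (nested_fans b N).
      e \<subseteq> {n, list_encode (tl (list_decode n)), list_encode (apex (list_decode n))}"
    by (fastforce simp: edges_nested_fans verts_nested_fans)
qed auto

lemma planar_nested_fans: "planar (nested_fans b N)"
proof -
  let ?W = "words_upto b N"
  \<comment> \<open>Preorder position in the tree of words, with the subtree of the letter \<open>0\<close> visited first. Parent
    edges go to one page and apex edges to the other.\<close>
  define pos where "pos n = real (card {y \<in> ?W. rev y < rev (list_decode n)})" for n
  define E where "E = {{list_encode x, list_encode (tl x)} | x. x \<in> ?W \<and> x \<noteq> []}"
  have mono: "pos (list_encode x) < pos (list_encode y)" if "x \<in> ?W" "rev x < rev y" for x y
  proof -
    have "{z \<in> ?W. rev z < rev x} \<subset> {z \<in> ?W. rev z < rev y}" using that by (auto dest: less_trans)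
    then show ?thesis by (simp add: pos_def psubset_card_mono finite_words_upto)
  qed
  have iff: "pos (list_encode x) < pos (list_encode y) \<longleftrightarrow> rev x < rev y" if "x \<in> ?W" "y \<in> ?W" for x y
    using mono[of x y] mono[of y x] that by (cases "rev x" "rev y" rule: linorder_cases) auto
  \<comment> \<open>Reversed, \<open>y\<close> is a proper prefix of \<open>x\<close> and so comes
    first in preorder: \<open>u\<close> encodes the parent or apex.\<close>
  have edge_ends: "v = list_encode x \<and> u = list_encode y"
    if uv: "{u, v} = {list_encode x, list_encode y}" "pos u < pos v"
      and x: "x \<in> ?W" "x \<noteq> []" "y = tl x \<or> y = apex x" for u v x y
  proof -
    have y: "suffix y x" "y \<noteq> x" using suffix_if_tl_or_apex[OF x(2,3)] by auto
    have yW: "y \<in> ?W" using x(1) y(1) by (rule suffix_in_words_upto)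
    from y(1) obtain z where "x = z @ y" by (auto simp: suffix_def)
    with y(2) have "rev y < rev x"
      using append_less_append_iff[of "rev y" "[]" "rev z"] by (cases "rev z") auto
    with iff x(1) yW have "pos (list_encode y) < pos (list_encode x)" by blast
    with uv show ?thesis by (auto simp: doubleton_eq_iff)
  qed
  show ?thesis
  proof (rule planar_if_two_page_book[of _ pos E])
    show "simple_graph (nested_fans b N)" by (rule simple_graph_nested_fans)
    show "inj_on pos (verts (nested_fans b N))"
    proof (rule inj_onI)
      fix m n assume mn: "m \<in> verts (nested_fans b N)" "n \<in> verts (nested_fans b N)" "pos m = pos n"
      then obtain x y where xy: "m = list_encode x" "n = list_encode y" "x \<in> ?W" "y \<in> ?W"
        by (auto simp: verts_nested_fans)
      with mn iff[of x y] iff[of y x] have "rev x = rev y" by auto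
      with xy show "m = n" by simp
    qed
    fix u v u' v'
    assume e: "{u, v} \<in> edges (nested_fans b N)" and e': "{u', v'} \<in> edges (nested_fans b N)"
      and page: "{u, v} \<in> E \<longleftrightarrow> {u', v'} \<in> E"
    show "\<not> (pos u < pos u' \<and> pos u' < pos v \<and> pos v < pos v')"
    proof
      assume ord: "pos u < pos u' \<and> pos u' < pos v \<and> pos v < pos v'"
      then have less: "pos u < pos v" "pos u' < pos v'" by auto
      show False
      proof (cases "{u, v} \<in> E")
        case True
        then obtain x where x: "{u, v} = {list_encode x, list_encode (tl x)}" "x \<in> ?W" "x \<noteq> []"
          by (auto simp: E_def)
        obtain x' where x': "{u', v'} = {list_encode x', list_encode (tl x')}" "x' \<in> ?W" "x' \<noteq> []"
          using True page by (auto simp: E_def)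
        have uv: "v = list_encode x" "u = list_encode (tl x)"
            "v' = list_encode x'" "u' = list_encode (tl x')"
          using edge_ends[OF x(1) less(1) x(2,3)] edge_ends[OF x'(1) less(2) x'(2,3)] by auto
        have "tl x \<in> ?W" "tl x' \<in> ?W"
          using x(2) x'(2) suffix_in_words_upto[OF _ suffix_tl] by auto
        with ord iff x x' uv have "rev (tl x) < rev (tl x')" "rev (tl x') < rev x" "rev x < rev x'"
          by auto
        moreover have "rev x = rev (tl x) @ [hd x]" "rev x' = rev (tl x') @ [hd x']"
          using x x' by (metis list.collapse rev.simps(2))+
        ultimately show False
          using parent_edges_noncrossing[of "rev (tl x)" "rev (tl x')" "hd x" "hd x'"] by auto
      next
        case False
        then obtain x where x: "{u, v} = {list_encode x, list_encode (apex x)}" "x \<in> ?W" "x \<noteq> []"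
          using e by (auto simp: E_def edges_nested_fans)
        obtain x' where x': "{u', v'} = {list_encode x', list_encode (apex x')}" "x' \<in> ?W" "x' \<noteq> []"
          using False page e' by (auto simp: E_def edges_nested_fans)
        have uv: "v = list_encode x" "u = list_encode (apex x)"
            "v' = list_encode x'" "u' = list_encode (apex x')"
          using edge_ends[OF x(1) less(1) x(2,3)] edge_ends[OF x'(1) less(2) x'(2,3)] by auto
        have "apex x \<in> ?W" "apex x' \<in> ?W"
          using x(2) x'(2) suffix_in_words_upto[OF _ suffix_apex] by auto
        with ord iff x x' uv have
          r: "rev (apex x) < rev (apex x')" "rev (apex x') < rev x" "rev x < rev x'"
          by auto
        \<comment> \<open>Nothing precedes \<open>[]\<close> in preorder, so only the first edge can
          belong to the outermost tree; the tree of \<open>x'\<close> was opened by a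
          \<open>0\<close>.\<close>
        have "apex x' \<noteq> []" using r(1) by auto
        then obtain w' where w': "x' = w' @ 0 # apex x'" using apex_decomp[of x'] by blast
        then have rx': "rev x' = rev (apex x') @ 0 # rev w'"
          by (metis append.assoc append_Cons append_Nil rev.simps(2) rev_append)
        show False
          using apex_decomp[of x]
        proof (elim disjE exE conjE)
          fix w assume w: "x = w @ 0 # apex x" "0 \<notin> set w"
          then have rx: "rev x = rev (apex x) @ 0 # rev w"
            by (metis append.assoc append_Cons append_Nil rev.simps(2) rev_append)
          with r rx' w(2) show False
            using apex_edges_noncrossing[of "rev (apex x)" "rev (apex x')" "0 # rev w" "rev w'" "rev w"]
            by auto
        next
          assume "0 \<notin> set x" "apex x = []"
          with r rx' show False
            using apex_edges_noncrossing[of "[]" "rev (apex x')" "rev x" "rev w'" "rev x"] by auto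
        qed
      qed
    qed
  qed
qed

section \<open>Lower bound on the rate\<close>

text \<open>For one fixed \<open>Y\<close>, the ranks given by an optimal elimination forest to
  components of surviving subtrees satisfy the hypotheses of \<open>potential_step\<close>.\<close>

lemma deleted_weight_lower_bound:
  assumes s: "2 \<le> s" and td: "treedepth (delete_verts (nested_fans (2 * s) N) Y) \<le> s\<^sup>2"
  shows "real N / 2 \<le> (2 * real s + 1 / 2) *
      (\<Sum>n<N. \<Sum>x\<in>words (2 * s) n. if list_encode x \<in> Y then 1 / real (2 * s) ^ n else 0) +
      (2 * (real s)\<^sup>2 + real s)"
proof -
  let ?G = "nested_fans (2 * s) N"
  define W where "W = words_upto (2 * s) N"
  note verts = verts_nested_fans[of "2 * s" N, folded W_def]
  note edges = edges_nested_fans[of "2 * s" N, folded W_def]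
  note suffix_W = suffix_in_words_upto[of _ "2 * s" N, folded W_def]
  let ?H = "delete_verts ?G Y"
  have "simple_graph ?H"
    using simple_graph_nested_fans[of "2 * s" N]
    by (auto simp: simple_graph_def delete_verts_def induced_subgraph_def)
  then obtain P where P: "elimination_forest ?H P (treedepth ?H)"
    by (rule elimination_forest_treedepth)
  obtain rank where rank_le: "\<And>S. rank S \<le> treedepth ?H"
    and rank_mono: "\<And>S S'. S \<noteq> {} \<Longrightarrow> S \<subseteq> S' \<Longrightarrow> rank S \<le> rank S'"
    and rank_less: "\<And>S S1 S2. S \<subseteq> verts ?H \<Longrightarrow> connected_graph (induced_subgraph ?H S) \<Longrightarrow>
       S1 \<subseteq> S \<Longrightarrow> S2 \<subseteq> S \<Longrightarrow> S1 \<noteq> {} \<Longrightarrow> S2 \<noteq> {} \<Longrightarrow> S1 \<inter> S2 = {} \<Longrightarrow>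
       rank S1 < rank S \<or> rank S2 < rank S"
    by (rule elimination_rank[OF P]) (rule that)
  \<comment> \<open>The rank of a surviving word is that of its component in what survives of its subtree.\<close>
  define A where "A x = {list_encode y | y. y \<in> W \<and> suffix x y} - Y" for x
  define C where "C x = reach ?G (A x) (list_encode x)" for x
  define g where "g x = rank (C x)" for x
  define D where "D = {x. list_encode x \<in> Y}"
  have C_ne: "C x \<noteq> {}" for x using reach_self by (force simp: C_def)
  have A: "list_encode x \<in> A x" if "x \<in> W" "x \<notin> D" for x using that by (auto simp: A_def D_def)
  have C_A: "C x \<subseteq> A x" if "x \<in> W" "x \<notin> D" for x
    unfolding C_def using A[OF that] by (rule reach_subset)
  have C_mono: "C x \<subseteq> C y" if "x \<in> W" "x \<noteq> []" "y = tl x \<or> y = apex x" "x \<notin> D" "y \<notin> D" for x y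
    unfolding C_def
  proof (rule reach_subset_reach)
    have y: "suffix y x" using suffix_if_tl_or_apex(1) that by blast
    then show "A x \<subseteq> A y" by (auto simp: A_def intro: suffix_order.trans)
    show "list_encode x \<in> A x" "list_encode y \<in> A y" using A that suffix_W[OF _ y] by auto
    show "{list_encode y, list_encode x} \<in> edges ?G" using that by (auto simp: edges insert_commute)
  qed
  have g_mono: "g x \<le> g y" if "x \<in> W" "x \<noteq> []" "y = tl x \<or> y = apex x" "x \<notin> D" "y \<notin> D" for x y
    unfolding g_def using C_ne C_mono[OF that] by (rule rank_mono)
  have "real N / 2 \<le> (2 * real s + 1 / 2) *
      (\<Sum>n<N. \<Sum>x\<in>words (2 * s) n. if x \<in> D then 1 / real (2 * s) ^ n else 0) +
      (2 * (real s)\<^sup>2 + real s)"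
  proof (rule weight_lower_bound[OF s refl, where g = g])
    fix n x assume n: "n < N" and "x \<in> words (2 * s) n"
    then have x: "x \<in> W" and child: "\<And>c. c < 2 * s \<Longrightarrow> c # x \<in> W" by (auto simp: words_def words_upto_def W_def)
    show "2 * s * potential (s\<^sup>2) s g D x + s \<le>
        (if x \<in> D then 4 * s\<^sup>2 + s else 0) + (\<Sum>c<2 * s. potential (s\<^sup>2) s g D (c # x))"
    proof (rule potential_step[OF s refl])
      show "g y \<le> s\<^sup>2" for y using rank_le td by (auto simp: g_def intro: order.trans)
      show "g (c # x) \<le> g x" if "c < 2 * s" "x \<notin> D" "c # x \<notin> D" for c
        using g_mono[of "c # x" x] child that by auto
      show "g x \<le> g (apex x)" if "x \<notin> D" "apex x \<notin> D"
        using g_mono[of x "apex x"] x that by (cases "x = []") auto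
      fix c c' assume c: "c < 2 * s" "c' < 2 * s" "c \<noteq> c'" "x \<notin> D" "c # x \<notin> D" "c' # x \<notin> D"
      have Cx: "C x \<subseteq> verts ?G - Y" using C_A[OF x c(4)] by (auto simp: A_def verts)
      show "g (c # x) < g x \<or> g (c' # x) < g x"
        unfolding g_def
      proof (rule rank_less)
        show "C x \<subseteq> verts ?H" using Cx by (simp add: delete_verts_def induced_subgraph_def)
        show "connected_graph (induced_subgraph ?H (C x))"
          using Cx unfolding delete_verts_def C_def by (rule connected_reach)
        show "C (c # x) \<subseteq> C x" "C (c' # x) \<subseteq> C x" using C_mono child c by auto
        \<comment> \<open>Suffixes of one word with equal length coincide, so different children
          have disjoint subtrees.\<close>
        have "\<not> (suffix (c # x) y \<and> suffix (c' # x) y)" for y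
          using c(3) suffix_length_suffix[of "c # x" y "c' # x"] suffix_length_le[of "c # x" x]
          by (auto simp: suffix_Cons)
        then have "A (c # x) \<inter> A (c' # x) = {}" by (auto simp: A_def list_encode_eq)
        with C_A child c show "C (c # x) \<inter> C (c' # x) = {}" by blast
      qed (rule C_ne)+
    qed
  qed
  then show ?thesis by (simp add: D_def)
qed

text \<open>Each level has total weight one, so thinness caps the average deleted weight at
  \<open>N / a\<close>. For \<open>8 * s \<le> a\<close> the bound for single sets would then force
  \<open>3 * s \<le> 2 * s + 1 / 2\<close>.\<close>

lemma fragile_rate_gt:
  assumes s: "2 \<le> s" and a: "8 * s \<le> a"
    and frag: "\<And>N. fractionally_fragile treedepth r (nested_fans (2 * s) N)"
  shows "real (s\<^sup>2) < r a"
proof (rule ccontr)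
  assume "\<not> real (s\<^sup>2) < r a"
  then have r: "r a \<le> real (s\<^sup>2)" by simp
  \<comment> \<open>\<open>B\<close> is the additive error in
    \<open>deleted_weight_lower_bound\<close>; taking \<open>N = 8 * B\<close> leaves
    \<open>N / 2 - B = 3 * B\<close>.\<close>
  define B where "B = 2 * s\<^sup>2 + s"
  define N where "N = 8 * B"
  let ?G = "nested_fans (2 * s) N"
  let ?I = "SIGMA n:{..<N}. words (2 * s) n"
  let ?k = "2 * real s + 1 / 2"
  have k: "0 < ?k" by simp
  have "0 < a" using a s by simp
  then obtain p where thin: "thin (1 / real a) (verts ?G) p"
    and p: "\<And>Y. Y \<in> set_pmf p \<Longrightarrow> real (treedepth (delete_verts ?G Y)) \<le> r a"
    using frag[of N] unfolding fractionally_fragile_def by blast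
  have "(real N / 2 - real B) / ?k \<le> 1 / real a * (\<Sum>(n, x)\<in>?I. 1 / real (2 * s) ^ n)"
  proof (rule thin_weight_le[OF thin, where v = "\<lambda>(n, x). list_encode x"])
    show "finite (verts ?G)" using simple_graph_nested_fans by (auto simp: simple_graph_def)
    show "(case i of (n, x) \<Rightarrow> list_encode x) \<in> verts ?G" if "i \<in> ?I" for i
      using that by (auto simp: verts_nested_fans words_def words_upto_def)
    show "0 \<le> (case i of (n, x) \<Rightarrow> 1 / real (2 * s) ^ n)" for i :: "nat \<times> nat list"
      by (auto split: prod.split)
    fix Y assume "Y \<in> set_pmf p"
    with p r have "treedepth (delete_verts ?G Y) \<le> s\<^sup>2" by (metis of_nat_le_iff order.trans)
    from deleted_weight_lower_bound[OF s this]
    have "real N / 2 - real B \<le> ?k *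
        (\<Sum>n<N. \<Sum>x\<in>words (2 * s) n. if list_encode x \<in> Y then 1 / real (2 * s) ^ n else 0)"
      by (simp add: B_def)
    also have "(\<Sum>n<N. \<Sum>x\<in>words (2 * s) n. if list_encode x \<in> Y then 1 / real (2 * s) ^ n else 0) =
        (\<Sum>i\<in>?I. if (case i of (n, x) \<Rightarrow> list_encode x) \<in> Y
          then (case i of (n, x) \<Rightarrow> 1 / real (2 * s) ^ n) else 0)"
      by (subst sum.Sigma) (auto intro: sum.cong)
    finally show "(real N / 2 - real B) / ?k \<le>
        (\<Sum>i\<in>?I. if (case i of (n, x) \<Rightarrow> list_encode x) \<in> Y
          then (case i of (n, x) \<Rightarrow> 1 / real (2 * s) ^ n) else 0)"
      using k by (simp add: pos_divide_le_eq mult.commute)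
  qed
  also have "(\<Sum>(n, x)\<in>?I. 1 / real (2 * s) ^ n) = (\<Sum>n<N. \<Sum>x\<in>words (2 * s) n. 1 / real (2 * s) ^ n)"
    by (subst sum.Sigma) auto
  also have "\<dots> = real N" using s by (simp add: card_words)
  finally have "(real N / 2 - real B) / ?k \<le> real N / real a" by simp
  also have "\<dots> \<le> real N / (8 * real s)"
    using a s by (intro divide_left_mono) auto
  finally have "3 * real B / ?k \<le> real B / real s" by (simp add: N_def)
  moreover have "0 < B" using s by (simp add: B_def)
  ultimately have "3 * real s \<le> ?k" using s by (simp add: field_simps)
  with s show False by simp
qed

theorem theorem23:
  fixes r :: "nat \<Rightarrow> real"
  assumes "mono r"
    and "\<And>a. 0 \<le> r a"
    and "\<And>G :: nat ugraph. simple_graph G \<Longrightarrow> planar G \<Longrightarrow> treewidth G \<le> 2 \<Longrightarrow>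
           fractionally_fragile treedepth r G"
  shows "r \<in> \<Omega>(\<lambda>a. real a ^ 2)"
proof (rule landau_omega.bigI[of "1 / 256"])
  show "\<forall>\<^sub>F a in sequentially. 1 / 256 * norm (real a ^ 2) \<le> norm (r a)"
    using eventually_ge_at_top[of 16]
  proof eventually_elim
    case (elim a)
    \<comment> \<open>The largest \<open>s\<close> with \<open>8 * s \<le> a\<close>. From
      \<open>16 \<le> a\<close> follows \<open>a \<le> 16 * s\<close>, whence the constant
      \<open>1 / 256\<close>.\<close>
    define s where "s = a div 8"
    have s: "2 \<le> s" "8 * s \<le> a" "a \<le> 16 * s" using elim by (auto simp: s_def)
    have "real (s\<^sup>2) < r a"
      using s(1,2) by (rule fragile_rate_gt)
        (intro assms(3) simple_graph_nested_fans planar_nested_fans treewidth_nested_fans)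
    moreover have "real (a\<^sup>2) \<le> real ((16 * s)\<^sup>2)" using s(3) by (intro of_nat_mono power_mono) auto
    ultimately show ?case by (simp add: power_mult_distrib)
  qed
qed simp

end
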